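(* Let $\mathcal{P}$ be a finite set of integer pairs $p=(p_1,p_2)$ with $0\le p_1\le p_2$ and $p_2\neq 0$, and let $\{A_p\}_{p\in\mathcal{P}}$ be real numbers satisfying $8\sum_{p\in\mathcal{P}}c_pA_p=1$ and such that $\sum_{p\in\mathcal{P}}\|p\|^2c_pA_p\neq0$, and put $$\mathcal{M}_\mathcal{P}=\frac12\Big(\sum_{p\in\mathcal{P}}\|p\|^2c_pA_p\Big)^{-1}.$$ For $f\in C^2(S)$, $x\in S\setminus\partial S$ and an integer $m\ge0$ define $$\Delta_mf(x)=\mathcal{M}_\mathcal{P}\,4^m\Big(\sum_{p\in\mathcal{P}}\Big(A_p\sum_{F_{w'}S\sim_pF_wS}B_{w'}(f)\Big)-B_w(f)\Big)\quad\text{for }x\in F_wS\text{ with }|w|=m,$$ where the inner sum runs over words $w'$ of length $m$ such that $F_{w'}S$ is a $p$-neighbor of $F_wS$. Then for every $f\in C^2(S)$, $$\Delta f(x)=\lim_{m\to\infty}\Delta_mf(x)$$ uniformly in $x\in S\setminus\partial S$.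
   Context: $\mu$ is Lebesgue measure on $\mathbb{R}^2$, $\|\cdot\|$ is the Euclidean norm, and $\Delta=\partial^2/\partial\xi_1^2+\partial^2/\partial\xi_2^2$. $S=[0,1]^2$ is the closed unit square with topological boundary $\partial S$, viewed as the self-similar set of the maps $F_i(x)=\frac12(x+q_i)$, $i=1,2,3,4$, with $q_1=(0,0)$, $q_2=(1,0)$, $q_3=(1,1)$, $q_4=(0,1)$. For a word $w=(w_1,\dots,w_m)\in\{1,2,3,4\}^m$ (length $|w|=m$), $F_w=F_{w_1}\circ\cdots\circ F_{w_m}$ (the identity if $m=0$); the $m$-cell $F_wS$ is a closed square of side $2^{-m}$. $B_w(f)=\frac{1}{\mu(F_wS)}\int_{F_wS}f\,d\mu$. $C^2(S)$ denotes the functions that are twice continuously differentiable on the closed square $S$ (up to the boundary). If $x$ lies in several $m$-cells, $\Delta_mf(x)$ may be formed with any of the corresponding words $w$. For $x=(x_1,x_2)$ and $l>0$, $\mathcal{D}(x,l)$ is the closed axis-parallel square with center $x$ and side length $l$. For an integer pair $p=(p_1,p_2)$ with $0\le p_1\le p_2$, $\mathcal{D}(x,l)\sim_p\mathcal{D}(x',l)$ ($p$-neighbors) means that either $|x_1-x_1'|=p_1l$ and $|x_2-x_2'|=p_2l$, or $|x_1-x_1'|=p_2l$ and $|x_2-x_2'|=p_1l$; this applies to the cells $F_wS$, which are such squares with $l=2^{-m}$. The constant $c_p$ is $\frac18$ if $p_1=p_2=0$; $\frac12$ if $p_1=0,p_2\ne0$ or $p_1=p_2\neq0$; and $1$ if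 $0<p_1<p_2$.
   Formalization: Uniformity over all of S∖∂S fails (f=1: boundary cells lack neighbors, error grows like 4^m); proved instead: convergence uniform on compact subsets of S∖∂S, and uniform over all x in S∖∂S and m-cells containing x all of whose p-neighbors (p∈P) lie in S. *)

theory Defs
  imports "HOL-Analysis.Analysis"
begin

definition unit_square :: "(real^2) set" where
  "unit_square = cbox (vector [0, 0]) (vector [1, 1])"

definition corner :: "nat \<Rightarrow> real^2" where
  "corner i = (if i = 1 then vector [0, 0] else if i = 2 then vector [1, 0]
               else if i = 3 then vector [1, 1] else vector [0, 1])"

definition F :: "nat \<Rightarrow> real^2 \<Rightarrow> real^2" where
  "F i x = (1/2) *\<^sub>R (x + corner i)"

definition words :: "nat \<Rightarrow> nat list set" where
  "words m = {w. set w \<subseteq> {1..4} \<and> length w = m}"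

primrec Fw :: "nat list \<Rightarrow> real^2 \<Rightarrow> real^2" where
  "Fw [] = id"
| "Fw (i # w) = F i \<circ> Fw w"

definition cell :: "nat list \<Rightarrow> (real^2) set" where
  "cell w = Fw w ` unit_square"

definition avg :: "nat list \<Rightarrow> (real^2 \<Rightarrow> real) \<Rightarrow> real" where
  "avg w f = 1 / measure lborel (cell w) * (LINT y:cell w|lborel. f y)"

definition sq :: "real^2 \<Rightarrow> real \<Rightarrow> (real^2) set" where
  "sq x l = {y. \<forall>i. \<bar>y $ i - x $ i\<bar> \<le> l / 2}"

definition p_neighbor :: "int \<times> int \<Rightarrow> (real^2) set \<Rightarrow> (real^2) set \<Rightarrow> bool" where
  "p_neighbor p Q Q' \<longleftrightarrow>
     (\<exists>x x' l. l > 0 \<and> Q = sq x l \<and> Q' = sq x' l \<and>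
        (\<bar>x $ 1 - x' $ 1\<bar> = of_int (fst p) * l \<and> \<bar>x $ 2 - x' $ 2\<bar> = of_int (snd p) * l \<or>
         \<bar>x $ 1 - x' $ 1\<bar> = of_int (snd p) * l \<and> \<bar>x $ 2 - x' $ 2\<bar> = of_int (fst p) * l))"

definition cst :: "int \<times> int \<Rightarrow> real" where
  "cst p = (if fst p = 0 \<and> snd p = 0 then 1/8
            else if fst p = 0 \<or> fst p = snd p then 1/2 else 1)"

definition pnorm :: "int \<times> int \<Rightarrow> real" where
  "pnorm p = norm (vector [of_int (fst p), of_int (snd p)] :: real^2)"

definition M_const :: "(int \<times> int) set \<Rightarrow> (int \<times> int \<Rightarrow> real) \<Rightarrow> real" where
  "M_const P A = 1/2 * inverse (\<Sum>p\<in>P. (pnorm p)\<^sup>2 * cst p * A p)"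

text \<open>The discrete Laplacian at level m = length w, formed with the word w; its value at a point x
  is obtained from any word w of length m with x in the cell of w.\<close>
definition discrete_laplacian ::
    "(int \<times> int) set \<Rightarrow> (int \<times> int \<Rightarrow> real) \<Rightarrow> (real^2 \<Rightarrow> real) \<Rightarrow> nat list \<Rightarrow> real" where
  "discrete_laplacian P A f w =
     M_const P A * 4 ^ length w *
       ((\<Sum>p\<in>P. A p * (\<Sum>w' | w' \<in> words (length w) \<and> p_neighbor p (cell w') (cell w). avg w' f))
        - avg w f)"

text \<open>All p-neighbors of the cell in the plane, for p in P, lie in the unit square. A cell near the
  boundary does not have this property: the inner sums above then have too few terms, and the
  factor 4 ^ m is not compensated (already for constant f). Every compact subset of the open
  square meets, for large m, only m-cells with this property.\<close>
definition complete_cell :: "(int \<times> int) set \<Rightarrow> nat list \<Rightarrow> bool" where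
  "complete_cell P w \<longleftrightarrow> (\<forall>p\<in>P. \<forall>Q. p_neighbor p Q (cell w) \<longrightarrow> Q \<subseteq> unit_square)"

text \<open>Twice continuously differentiable up to the boundary: derivatives are taken within S, so
  values of f outside S are irrelevant. The derivatives are unique for the closed square, also at
  boundary points, and they are the continuous extensions of the derivatives in the interior.\<close>
definition C2_on :: "(real^2) set \<Rightarrow> (real^2 \<Rightarrow> real) \<Rightarrow> bool" where
  "C2_on S f \<longleftrightarrow>
     (\<exists>(Df :: real^2 \<Rightarrow> ((real^2) \<Rightarrow>\<^sub>L real)) (D2f :: real^2 \<Rightarrow> ((real^2) \<Rightarrow>\<^sub>L ((real^2) \<Rightarrow>\<^sub>L real))).
        (\<forall>x\<in>S. (f has_derivative blinfun_apply (Df x)) (at x within S)) \<and>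
        (\<forall>x\<in>S. (Df has_derivative blinfun_apply (D2f x)) (at x within S)) \<and>
        continuous_on S D2f)"

definition partial_deriv :: "2 \<Rightarrow> (real^2 \<Rightarrow> real) \<Rightarrow> real^2 \<Rightarrow> real" where
  "partial_deriv i f x = deriv (\<lambda>t. f (x + t *\<^sub>R axis i 1)) 0"

definition laplacian :: "(real^2 \<Rightarrow> real) \<Rightarrow> real^2 \<Rightarrow> real" where
  "laplacian f x = partial_deriv 1 (partial_deriv 1 f) x + partial_deriv 2 (partial_deriv 2 f) x"

end

theory Submission
  imports Defs
begin

text \<open>
  Put \<open>l = 2\<^sup>-\<^sup>m\<close>. If all \<open>p\<close>-neighbors of an \<open>m\<close>-cell \<open>C\<close> lie in the square, then they
  are exactly the translates of \<open>C\<close> by \<open>l q\<close>, where \<open>q\<close> runs over the integer vectors that arise from \<open>p\<close> by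
  sign changes and by exchanging the coordinates. There are \<open>8 c\<^sub>p\<close> such vectors, so the
  normalization \<open>8 \<Sum> c\<^sub>p A\<^sub>p = 1\<close> distributes the subtracted mean over \<open>C\<close> among the
  neighbors, and the discrete Laplacian becomes the mean over \<open>y \<in> C\<close> of a difference quotient,
  \<open>M l\<^sup>-\<^sup>2 \<Sum>\<^sub>p A\<^sub>p \<Sum>\<^sub>q (f (y + l q) - f y)\<close>
  (\<open>discrete_laplacian_has_integral\<close>).

  Expand each difference to second order. The symmetries of the set of vectors \<open>q\<close> cancel
  the first-order terms as well as the mixed second derivatives, and they give the two
  pure second derivatives the same weight. What remains is \<open>2 l\<^sup>2 c\<^sub>p \<parallel>p\<parallel>\<^sup>2 \<Delta>f(y)\<close> for each
  \<open>p\<close>; after weighting by \<open>A\<^sub>p\<close>, the factor \<open>M l\<^sup>-\<^sup>2\<close> turns the sum into \<open>\<Delta>f(y)\<close>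
  (\<open>difference_sum_estimate\<close>). The remainder is \<open>o(1)\<close> uniformly in \<open>y\<close>, because the second
  derivative is uniformly continuous on the compact square (\<open>uniform_second_order_Taylor\<close>).
  For the same reason \<open>\<Delta>f(y)\<close> is uniformly close to \<open>\<Delta>f(x)\<close> for \<open>x\<close> and \<open>y\<close> in the same cell.
  This proves the uniform estimate over all cells with a full set of neighbors.

  A compact subset of the open square has positive distance from the boundary, whereas the
  neighbors of a cell stay within a fixed multiple of \<open>l\<close>. Hence all cells that meet the
  compact set are eventually of this kind (\<open>eventually_complete_cell\<close>), and locally uniform
  convergence follows for every choice of the words.\<close>

section \<open>Cells as squares of the dyadic grid\<close>

definition ivec :: "int \<times> int \<Rightarrow> real^2" where
  "ivec q = vector [of_int (fst q), of_int (snd q)]"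

lemma ivec_nth [simp]: "ivec q $ 1 = of_int (fst q)" "ivec q $ 2 = of_int (snd q)"
  by (simp_all add: ivec_def)

lemma ivec_add: "ivec (p + q) = ivec p + ivec q"
  by (simp add: vec_eq_iff forall_2)

definition dyadic_square :: "nat \<Rightarrow> int \<times> int \<Rightarrow> (real^2) set" where
  "dyadic_square m g = cbox ((1/2)^m *\<^sub>R ivec g) ((1/2)^m *\<^sub>R ivec (g + (1, 1)))"

lemma mem_dyadic_square:
  "y \<in> dyadic_square m g \<longleftrightarrow>
     (1/2)^m * of_int (fst g) \<le> y $ 1 \<and> y $ 1 \<le> (1/2)^m * (of_int (fst g) + 1) \<and>
     (1/2)^m * of_int (snd g) \<le> y $ 2 \<and> y $ 2 \<le> (1/2)^m * (of_int (snd g) + 1)"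
  by (auto simp: dyadic_square_def mem_box_cart forall_2)

lemma unit_square_eq_dyadic_square: "unit_square = dyadic_square 0 (0, 0)"
  by (auto simp: mem_dyadic_square unit_square_def mem_box_cart forall_2)

text \<open>The integer position of a cell in the dyadic grid. The outermost map of a word acts last and
  halves everything inside it, so the first letter carries the most significant binary digits of
  the two coordinates. The cases follow the values of \<open>corner\<close>.\<close>
primrec grid :: "nat list \<Rightarrow> int \<times> int" where
  "grid [] = (0, 0)"
| "grid (i # w) = grid w +
     (if i = 2 \<or> i = 3 then 2 ^ length w else 0, if i = 1 \<or> i = 2 then 0 else 2 ^ length w)"

text \<open>All compositions \<open>F\<^sub>w\<close> of the same length have the same linear part; only the integer
  position \<open>grid w\<close> depends on the word.\<close>
lemma Fw_eq: "Fw w x = (1/2) ^ length w *\<^sub>R (ivec (grid w) + x)"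
proof (induction w)
  case Nil
  then show ?case by (simp add: vec_eq_iff forall_2)
next
  case (Cons i w)
  then show ?case
    by (auto simp: F_def corner_def vec_eq_iff forall_2 field_simps power_one_over)
qed

lemma cell_eq_dyadic_square: "cell w = dyadic_square (length w) (grid w)"
proof -
  let ?l = "(1/2::real) ^ length w"
  have "Fw w = (\<lambda>x. ?l *\<^sub>R x + ?l *\<^sub>R ivec (grid w))"
    by (simp add: fun_eq_iff Fw_eq algebra_simps)
  moreover have "(vector [0, 0] :: real^2) \<in> cbox (vector [0, 0]) (vector [1, 1])"
    by (simp add: mem_box_cart forall_2)
  then have "cbox (vector [0, 0] :: real^2) (vector [1, 1]) \<noteq> {}" by blast
  ultimately show ?thesis
    unfolding cell_def unit_square_def dyadic_square_def
    by (simp add: image_affinity_cbox)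
       (rule arg_cong2[where f=cbox]; simp add: vec_eq_iff forall_2 algebra_simps)
qed

lemma grid_in_range:
  assumes "w \<in> words m"
  shows "grid w \<in> {0..<2^m} \<times> {0..<2^m}"
  using assms
proof (induction w arbitrary: m)
  case (Cons i w)
  then obtain k where "m = Suc k" "w \<in> words k" by (auto simp: words_def)
  with Cons.IH[of k] show ?case by (auto simp: words_def mem_Times_iff)
qed (auto simp: words_def)

text \<open>The positions of the subwords lie in \<open>{0..<2\<^sup>k}\<close>, so the digit added by the first letter can
  be read off from the position. Together with surjectivity below, this turns sums over
  words into sums over grid positions.\<close>
lemma inj_on_grid: "inj_on grid (words m)"
proof (rule inj_onI)
  show "w = v" if "w \<in> words m" "v \<in> words m" "grid w = grid v" for w v
    using that
  proof (induction w arbitrary: v m)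
    case Nil
    then show ?case by (auto simp: words_def)
  next
    case (Cons i w)
    then obtain k where k: "m = Suc k" "w \<in> words k" by (auto simp: words_def)
    then obtain j u where v: "v = j # u" "u \<in> words k"
      using Cons.prems by (cases v) (auto simp: words_def)
    have len: "length w = k" "length u = k" using k v by (auto simp: words_def)
    have ij: "i \<in> {1,2,3,4}" "j \<in> {1,2,3,4}"
      using Cons.prems v by (auto simp: words_def)
    have r: "grid w \<in> {0..<2^k} \<times> {0..<2^k}" "grid u \<in> {0..<2^k} \<times> {0..<2^k}"
      using grid_in_range k v by auto
    have "i = j \<and> grid w = grid u"
      using Cons.prems(3) r ij unfolding v
      by (auto simp: len mem_Times_iff prod_eq_iff split: if_splits)
    then show ?case using Cons.IH[OF k(2) v(2)] v by simp
  qed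
qed

lemma grid_surj:
  assumes "g \<in> {0..<2^m} \<times> {0..<2^m}"
  obtains w where "w \<in> words m" "grid w = g"
  using assms
proof (induction m arbitrary: g thesis)
  case 0
  then show ?case using 0(1)[of "[]"] by (auto simp: words_def)
next
  case (Suc m)
  define a where "a = (if fst g < 2^m then 0 else 2^m :: int)"
  define b where "b = (if snd g < 2^m then 0 else 2^m :: int)"
  define i :: nat where "i = (if a = 0 then if b = 0 then 1 else 4 else if b = 0 then 2 else 3)"
  have "g - (a, b) \<in> {0..<2^m} \<times> {0..<2^m}"
    using Suc.prems by (auto simp: a_def b_def mem_Times_iff)
  from Suc.IH[OF _ this] obtain w where w: "w \<in> words m" "grid w = g - (a, b)" by blast
  have "i # w \<in> words (Suc m)" using w by (auto simp: words_def i_def)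
  moreover have "grid (i # w) = g"
    using w by (auto simp: words_def i_def a_def b_def prod_eq_iff)
  ultimately show ?case using Suc.prems by blast
qed

section \<open>Neighbors and the symmetric set of offsets\<close>

definition neighbor_offsets :: "int \<times> int \<Rightarrow> (int \<times> int) set" where
  "neighbor_offsets p =
     {q. \<bar>fst q\<bar> = fst p \<and> \<bar>snd q\<bar> = snd p \<or> \<bar>fst q\<bar> = snd p \<and> \<bar>snd q\<bar> = fst p}"

lemma sq_eq_cbox: "sq x l = cbox (x - vec (l/2)) (x + vec (l/2))"
proof -
  have "\<bar>a - b\<bar> \<le> l/2 \<longleftrightarrow> b - l/2 \<le> a \<and> a \<le> b + l/2" for a b :: real by linarith
  then show ?thesis by (simp add: sq_def set_eq_iff mem_box_cart)
qed

text \<open>A square determines its center and side, so the existential quantifiers in the neighbor relation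
  have only one possible witness.\<close>
lemma sq_eq_iff:
  assumes "l > 0" "l' > 0"
  shows "sq x l = sq x' l' \<longleftrightarrow> x = x' \<and> l = l'"
proof
  assume "sq x l = sq x' l'"
  moreover have "sq x l \<noteq> {}" using assms by (auto simp: sq_def intro!: exI[of _ x])
  ultimately have "x - vec (l/2) = x' - vec (l'/2) \<and> x + vec (l/2) = x' + vec (l'/2)"
    unfolding sq_eq_cbox eq_cbox by auto
  then have "\<forall>i. x$i - l/2 = x'$i - l'/2" "\<forall>i. x$i + l/2 = x'$i + l'/2"
    by (auto simp: vec_eq_iff)
  then have *: "x$i - l/2 = x'$i - l'/2" "x$i + l/2 = x'$i + l'/2" for i by auto
  have "x $ i = x' $ i" for i using *[of i] by linarith
  moreover have "l = l'" using *[of 1] by linarith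
  ultimately show "x = x' \<and> l = l'" by (simp add: vec_eq_iff)
qed auto

lemma dyadic_square_eq_sq:
  "dyadic_square m g = sq ((1/2)^m *\<^sub>R (ivec g + vec (1/2))) ((1/2)^m)"
  unfolding dyadic_square_def sq_eq_cbox
  by (rule arg_cong2[where f = cbox]; simp add: vec_eq_iff forall_2 algebra_simps)

text \<open>The neighbor relation is defined for squares in the plane at arbitrary position, but the neighbors
  of a grid square are again grid squares: their centers differ by integer multiples of the side.\<close>
lemma p_neighbor_dyadic_square_iff:
  "p_neighbor p Q (dyadic_square m g) \<longleftrightarrow> (\<exists>q\<in>neighbor_offsets p. Q = dyadic_square m (g + q))"
proof
  define l where "l = (1/2::real)^m"
  have l: "l > 0" by (simp add: l_def)
  assume "p_neighbor p Q (dyadic_square m g)"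
  then obtain x where Q: "Q = sq x l" and
    d: "\<bar>x $ 1 - l * (of_int (fst g) + 1/2)\<bar> = of_int (fst p) * l \<and>
        \<bar>x $ 2 - l * (of_int (snd g) + 1/2)\<bar> = of_int (snd p) * l \<or>
        \<bar>x $ 1 - l * (of_int (fst g) + 1/2)\<bar> = of_int (snd p) * l \<and>
        \<bar>x $ 2 - l * (of_int (snd g) + 1/2)\<bar> = of_int (fst p) * l"
    unfolding p_neighbor_def dyadic_square_eq_sq using l
    by (auto simp: sq_eq_iff simp flip: l_def)
  have ex: "\<exists>k. \<bar>k\<bar> = n \<and> t = l * (of_int (c + k) + 1/2)"
    if "\<bar>t - l * (of_int c + 1/2)\<bar> = of_int n * l" for t c n
  proof -
    have "n \<ge> 0" using that l abs_ge_zero[of "t - l * (of_int c + 1/2)"]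
      by (metis of_int_0_le_iff zero_le_mult_iff not_less)
    then show ?thesis using that
      by (cases "t - l * (of_int c + 1/2) \<ge> 0")
         (auto simp: algebra_simps intro: exI[of _ n] exI[of _ "-n"])
  qed
  obtain q where q: "q \<in> neighbor_offsets p"
      "x $ 1 = l * (of_int (fst g + fst q) + 1/2)" "x $ 2 = l * (of_int (snd g + snd q) + 1/2)"
    using d
  proof
    assume "\<bar>x $ 1 - l * (of_int (fst g) + 1/2)\<bar> = of_int (fst p) * l \<and>
        \<bar>x $ 2 - l * (of_int (snd g) + 1/2)\<bar> = of_int (snd p) * l"
    then obtain k1 k2 where "\<bar>k1\<bar> = fst p \<and> x$1 = l * (of_int (fst g + k1) + 1/2)"
       "\<bar>k2\<bar> = snd p \<and> x$2 = l * (of_int (snd g + k2) + 1/2)"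
      using ex by blast
    then show ?thesis by (intro that[of "(k1, k2)"]) (auto simp: neighbor_offsets_def)
  next
    assume "\<bar>x $ 1 - l * (of_int (fst g) + 1/2)\<bar> = of_int (snd p) * l \<and>
        \<bar>x $ 2 - l * (of_int (snd g) + 1/2)\<bar> = of_int (fst p) * l"
    then obtain k1 k2 where "\<bar>k1\<bar> = snd p \<and> x$1 = l * (of_int (fst g + k1) + 1/2)"
       "\<bar>k2\<bar> = fst p \<and> x$2 = l * (of_int (snd g + k2) + 1/2)"
      using ex by blast
    then show ?thesis by (intro that[of "(k1, k2)"]) (auto simp: neighbor_offsets_def)
  qed
  then have "x = l *\<^sub>R (ivec (g + q) + vec (1/2))" by (simp add: vec_eq_iff forall_2)
  with Q q(1) show "\<exists>q\<in>neighbor_offsets p. Q = dyadic_square m (g + q)"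
    by (auto simp: dyadic_square_eq_sq l_def)
next
  assume "\<exists>q\<in>neighbor_offsets p. Q = dyadic_square m (g + q)"
  then obtain q where "q \<in> neighbor_offsets p" "Q = dyadic_square m (g + q)" by blast
  then show "p_neighbor p Q (dyadic_square m g)"
    unfolding p_neighbor_def dyadic_square_eq_sq
    by (intro exI[of _ "(1/2)^m *\<^sub>R (ivec (g + q) + vec (1/2))"]
              exI[of _ "(1/2)^m *\<^sub>R (ivec g + vec (1/2))"] exI[of _ "(1/2)^m"])
       (auto simp: neighbor_offsets_def ivec_add algebra_simps abs_mult)
qed

lemma neighbor_offsets_eq:
  assumes "0 \<le> a" "0 \<le> b"
  shows "neighbor_offsets (a, b) =
      {(a, b), (a, -b), (-a, b), (-a, -b), (b, a), (b, -a), (-b, a), (-b, -a)}"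
proof -
  have "\<bar>x\<bar> = c \<longleftrightarrow> x = c \<or> x = -c" if "0 \<le> c" for x c :: int using that by linarith
  then show ?thesis
    using assms unfolding neighbor_offsets_def by (simp add: set_eq_iff) blast
qed

text \<open>The weight \<open>cst\<close> is what makes the orbit sum uniform: among the eight images of \<open>(a, b)\<close> under
  the symmetries of the square, each distinct one occurs \<open>1 / cst (a, b)\<close> times.\<close>
lemma sum_neighbor_offsets:
  fixes h :: "int \<times> int \<Rightarrow> real"
  assumes "0 \<le> a" "a \<le> b"
  shows "(\<Sum>q\<in>neighbor_offsets (a, b). h q) = cst (a, b) *
    (h (a, b) + h (a, -b) + h (-a, b) + h (-a, -b) + h (b, a) + h (b, -a) + h (-b, a) + h (-b, -a))"
proof -
  note eq = neighbor_offsets_eq[OF assms(1) order.trans[OF assms]]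
  consider "a = 0" "b = 0" | "a = 0" "b > 0" | "a = b" "b > 0" | "0 < a" "a < b" using assms by linarith
  then show ?thesis
  proof cases
    case 2
    have "neighbor_offsets (a, b) = {(0, b), (0, -b), (b, 0), (-b, 0)}"
      unfolding eq using 2 by auto
    then show ?thesis using 2 by (simp add: cst_def)
  next
    case 3
    have "neighbor_offsets (a, b) = {(b, b), (b, -b), (-b, b), (-b, -b)}"
      unfolding eq using 3 by auto
    then show ?thesis using 3 by (simp add: cst_def)
  next
    case 4
    then show ?thesis unfolding eq by (simp add: cst_def)
  next
    case 1
    have "neighbor_offsets (a, b) = {(0, 0)}" unfolding eq using 1 by auto
    then show ?thesis using 1 by (simp add: cst_def)
  qed
qed

lemma finite_neighbor_offsets: "finite (neighbor_offsets p)"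
proof (rule finite_subset)
  let ?R = "{-\<bar>fst p\<bar> - \<bar>snd p\<bar>..\<bar>fst p\<bar> + \<bar>snd p\<bar>}"
  show "neighbor_offsets p \<subseteq> ?R \<times> ?R" by (auto simp: neighbor_offsets_def)
qed auto

lemma pnorm_squared: "(pnorm p)\<^sup>2 = (of_int (fst p))\<^sup>2 + (of_int (snd p))\<^sup>2"
  unfolding pnorm_def power2_norm_eq_inner by (simp add: inner_vec_def sum_2 power2_eq_square)

lemma ivec_decomp: "ivec q = of_int (fst q) *\<^sub>R axis 1 1 + of_int (snd q) *\<^sub>R axis 2 1"
  by (simp add: vec_eq_iff forall_2 axis_def)

lemma card_neighbor_offsets:
  assumes "0 \<le> fst p" "fst p \<le> snd p"
  shows "real (card (neighbor_offsets p)) = 8 * cst p"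
  using sum_neighbor_offsets[OF assms, of "\<lambda>_. 1"] by simp

text \<open>The offsets are symmetric about the origin, hence the first-order Taylor terms cancel.\<close>
lemma sum_linear_neighbor_offsets:
  fixes L :: "(real^2) \<Rightarrow>\<^sub>L real"
  assumes "0 \<le> fst p" "fst p \<le> snd p"
  shows "(\<Sum>q\<in>neighbor_offsets p. L (ivec q)) = 0"
  using sum_neighbor_offsets[OF assms, of "\<lambda>q. L (ivec q)"]
  by (simp add: ivec_decomp blinfun.bilinear_simps)

text \<open>The sign changes remove the mixed products, and the exchange of coordinates gives the squares of
  both coordinates the same sum; only a multiple of the trace survives.\<close>
lemma sum_quadratic_neighbor_offsets:
  fixes B :: "(real^2) \<Rightarrow>\<^sub>L (real^2) \<Rightarrow>\<^sub>L real"
  assumes "0 \<le> fst p" "fst p \<le> snd p"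
  shows "(\<Sum>q\<in>neighbor_offsets p. B (ivec q) (ivec q)) =
    4 * cst p * (pnorm p)\<^sup>2 * (B (axis 1 1) (axis 1 1) + B (axis 2 1) (axis 2 1))"
  using sum_neighbor_offsets[OF assms, of "\<lambda>q. B (ivec q) (ivec q)"] unfolding pnorm_squared
  by (simp add: ivec_decomp blinfun.bilinear_simps power2_eq_square algebra_simps)

section \<open>Second derivatives\<close>

text \<open>The mean value inequality is used twice along the segment from \<open>x\<close> to \<open>x + h\<close>. Applied to
  the gradient, with the uniform continuity of \<open>D2f\<close>, it shows that \<open>Df (x + t h)\<close> differs from
  \<open>Df x + D2f x (t h)\<close> by at most \<open>e \<parallel>h\<parallel>\<close>. Applied to
  \<open>g t = f (x + t h) - t Df x h - t\<^sup>2 D2f x h h / 2\<close>, whose derivative is this difference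
  evaluated at \<open>h\<close>, it gives the claim. All derivatives are taken within \<open>S\<close>, so the
  estimate holds up to the boundary.\<close>
lemma uniform_second_order_Taylor:
  fixes f :: "'a::real_normed_vector \<Rightarrow> real"
    and Df :: "'a \<Rightarrow> 'a \<Rightarrow>\<^sub>L real" and D2f :: "'a \<Rightarrow> 'a \<Rightarrow>\<^sub>L 'a \<Rightarrow>\<^sub>L real"
  assumes S: "compact S" "convex S"
    and Df: "\<And>x. x \<in> S \<Longrightarrow> (f has_derivative Df x) (at x within S)"
    and D2f: "\<And>x. x \<in> S \<Longrightarrow> (Df has_derivative D2f x) (at x within S)"
    and cont: "continuous_on S D2f" and "e > 0"
  obtains d where "d > 0"
    "\<And>x h. x \<in> S \<Longrightarrow> x + h \<in> S \<Longrightarrow> norm h < d \<Longrightarrow>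
       \<bar>f (x + h) - f x - Df x h - D2f x h h / 2\<bar> \<le> e * (norm h)\<^sup>2"
proof -
  obtain d where d: "d > 0" "\<And>x y. x \<in> S \<Longrightarrow> y \<in> S \<Longrightarrow> dist y x < d \<Longrightarrow> dist (D2f y) (D2f x) < e"
    using compact_uniformly_continuous[OF cont S(1)] \<open>e > 0\<close>
    unfolding uniformly_continuous_on_def by metis
  have "\<bar>f (x + h) - f x - Df x h - D2f x h h / 2\<bar> \<le> e * (norm h)\<^sup>2"
    if x: "x \<in> S" "x + h \<in> S" and h: "norm h < d" for x h
  proof -
    have seg: "x + t *\<^sub>R h \<in> S" if "t \<in> {0..1}" for t :: real
    proof -
      have "(1 - t) *\<^sub>R x + t *\<^sub>R (x + h) \<in> S"
        using that x S(2) by (intro convexD_alt) auto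
      then show ?thesis by (simp add: algebra_simps)
    qed
    define I where "I = (\<lambda>t::real. x + t *\<^sub>R h) ` {0..1}"
    have IS: "I \<subseteq> S" using seg by (auto simp: I_def)
    have gradient: "norm (Df (x + t *\<^sub>R h) - Df x - D2f x (t *\<^sub>R h)) \<le> norm h * e"
      if t: "t \<in> {0..1}" for t
    proof -
      have "norm (Df (x + t *\<^sub>R h) - Df x - D2f x (x + t *\<^sub>R h - x)) \<le> norm (x + t *\<^sub>R h - x) * e"
      proof (rule differentiable_bound_linearization[where S = I])
        fix s :: real assume s: "s \<in> {0..1}"
        have "x + (s * t) *\<^sub>R h \<in> I"
          unfolding I_def using s t by (intro imageI) (auto simp: mult_le_one)
        then show "x + s *\<^sub>R (x + t *\<^sub>R h - x) \<in> I" by simp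
      next
        fix y assume "y \<in> I"
        then show "(Df has_derivative D2f y) (at y within I)"
          using D2f IS has_derivative_subset by blast
      next
        fix y assume y: "y \<in> I"
        then obtain s where s: "s \<in> {0..1}" "y = x + s *\<^sub>R h" by (auto simp: I_def)
        then have "norm (s *\<^sub>R h) \<le> norm h" by (auto intro: mult_left_le_one_le)
        then have "dist y x < d" using s h by (simp add: dist_norm)
        then have "norm (D2f y - D2f x) < e"
          using d(2) x(1) y IS by (auto simp: dist_norm)
        moreover have "onorm (blinfun_apply (D2f y) - blinfun_apply (D2f x)) = norm (D2f y - D2f x)"
          by (simp add: norm_blinfun.rep_eq minus_blinfun.rep_eq fun_diff_def)
        ultimately show "onorm (blinfun_apply (D2f y) - blinfun_apply (D2f x)) \<le> e" by simp
      next
        show "x \<in> I" unfolding I_def by (rule image_eqI[of _ _ 0]) auto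
      qed
      also have "\<dots> \<le> norm h * e"
        using t \<open>e > 0\<close> by (auto intro!: mult_right_mono mult_left_le_one_le)
      finally show ?thesis by simp
    qed
    define g where "g = (\<lambda>t. f (x + t *\<^sub>R h) - t * Df x h - t\<^sup>2 * (D2f x h h / 2))"
    have "norm (g 1 - g 0) \<le> (norm h * e * norm h) * norm (1 - 0 :: real)"
    proof (rule field_differentiable_bound[where S = "{0..1}"])
      fix t :: real assume t: "t \<in> {0..1}"
      have "((\<lambda>t. x + t *\<^sub>R h) has_derivative (\<lambda>s. s *\<^sub>R h)) (at t within {0..1})"
        by (auto intro!: derivative_eq_intros)
      moreover have "(f has_derivative Df (x + t *\<^sub>R h)) (at (x + t *\<^sub>R h) within (\<lambda>t. x + t *\<^sub>R h) ` {0..1})"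
        using Df[OF seg[OF t]] IS has_derivative_subset unfolding I_def by blast
      ultimately have "((\<lambda>t. f (x + t *\<^sub>R h)) has_derivative (\<lambda>s. Df (x + t *\<^sub>R h) (s *\<^sub>R h))) (at t within {0..1})"
        by (rule has_derivative_in_compose)
      then have "((\<lambda>t. f (x + t *\<^sub>R h)) has_real_derivative Df (x + t *\<^sub>R h) h) (at t within {0..1})"
        by (simp add: has_field_derivative_def blinfun.scaleR_right mult_commute_abs)
      then show "(g has_real_derivative (Df (x + t *\<^sub>R h) - Df x - D2f x (t *\<^sub>R h)) h) (at t within {0..1})"
        unfolding g_def
        by (auto intro!: derivative_eq_intros simp: blinfun.bilinear_simps algebra_simps)
      show "norm ((Df (x + t *\<^sub>R h) - Df x - D2f x (t *\<^sub>R h)) h) \<le> norm h * e * norm h"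
        using norm_blinfun[of "Df (x + t *\<^sub>R h) - Df x - D2f x (t *\<^sub>R h)" h] gradient[OF t]
        by (meson mult_right_mono norm_ge_zero order_trans)
    qed auto
    then show ?thesis by (simp add: g_def power2_eq_square mult_ac algebra_simps)
  qed
  with d(1) that show thesis by blast
qed

lemma partial_deriv_eq:
  assumes "(f has_derivative f') (at x)"
  shows "partial_deriv i f x = f' (axis i 1)"
proof -
  have "((\<lambda>t. x + t *\<^sub>R axis i 1) has_derivative (\<lambda>t. t *\<^sub>R axis i 1)) (at (0::real))"
    by (auto intro!: derivative_eq_intros)
  moreover have "(f has_derivative f') (at (x + 0 *\<^sub>R axis i 1))" using assms by simp
  ultimately have "((\<lambda>t. f (x + t *\<^sub>R axis i 1)) has_derivative (\<lambda>t. f' (t *\<^sub>R axis i 1))) (at 0)"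
    by (rule has_derivative_compose)
  moreover have "linear f'" using assms has_derivative_linear by blast
  ultimately have "((\<lambda>t. f (x + t *\<^sub>R axis i 1)) has_real_derivative f' (axis i 1)) (at 0)"
    by (simp add: has_field_derivative_def linear_cmul mult_commute_abs)
  then show ?thesis unfolding partial_deriv_def by (rule DERIV_imp_deriv)
qed

text \<open>At interior points the derivatives within \<open>S\<close> are ordinary derivatives, and the first partial
  derivatives coincide with \<open>Df\<close> on a whole neighborhood, so they may be differentiated again.\<close>
lemma laplacian_eq:
  assumes Df: "\<And>x. x \<in> S \<Longrightarrow> (f has_derivative blinfun_apply (Df x)) (at x within S)"
    and D2f: "\<And>x. x \<in> S \<Longrightarrow> (Df has_derivative blinfun_apply (D2f x)) (at x within S)"
    and x: "x \<in> interior S"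
  shows "laplacian f x = D2f x (axis 1 1) (axis 1 1) + D2f x (axis 2 1) (axis 2 1)"
proof -
  have first: "partial_deriv i f y = Df y (axis i 1)" if "y \<in> interior S" for i y
    using Df[of y] that interior_subset[of S] at_within_interior[OF that]
    by (intro partial_deriv_eq) auto
  have "partial_deriv i (partial_deriv i f) x = D2f x (axis i 1) (axis i 1)" for i
  proof (rule partial_deriv_eq[where f' = "\<lambda>h. D2f x h (axis i 1)"])
    have "(Df has_derivative D2f x) (at x)"
      using D2f[of x] x interior_subset[of S] at_within_interior[OF x] by auto
    then have "((\<lambda>y. Df y (axis i 1)) has_derivative (\<lambda>h. D2f x h (axis i 1))) (at x)"
      by (auto intro!: derivative_eq_intros simp: blinfun.bilinear_simps)
    then show "(partial_deriv i f has_derivative (\<lambda>h. D2f x h (axis i 1))) (at x)"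
      by (rule has_derivative_transform_within_open[OF _ open_interior x]) (simp add: first)
  qed
  then show ?thesis by (simp add: laplacian_def)
qed

text \<open>The consistency of the difference scheme at one point. The factor \<open>1/2\<close> of the Taylor formula
  and the orbit sum \<open>4 c\<^sub>p \<parallel>p\<parallel>\<^sup>2\<close> of the quadratic form combine to \<open>2 c\<^sub>p \<parallel>p\<parallel>\<^sup>2\<close>;
  \<open>M_const\<close> is the reciprocal of the sum of these numbers weighted by \<open>A\<^sub>p\<close>. The remainder is of order \<open>e l\<^sup>2\<close> and is multiplied by \<open>l\<^sup>-\<^sup>2\<close>.\<close>
lemma difference_sum_estimate:
  fixes Df :: "(real^2) \<Rightarrow>\<^sub>L real" and B :: "(real^2) \<Rightarrow>\<^sub>L (real^2) \<Rightarrow>\<^sub>L real" and l e :: real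
  assumes P: "\<forall>p\<in>P. 0 \<le> fst p \<and> fst p \<le> snd p"
    and nz: "(\<Sum>p\<in>P. (pnorm p)\<^sup>2 * cst p * A p) \<noteq> 0"
    and l: "l > 0"
    and taylor: "\<And>p q. p \<in> P \<Longrightarrow> q \<in> neighbor_offsets p \<Longrightarrow>
      \<bar>f (y + l *\<^sub>R ivec q) - f y - Df (l *\<^sub>R ivec q) - B (l *\<^sub>R ivec q) (l *\<^sub>R ivec q) / 2\<bar>
        \<le> e * (norm (l *\<^sub>R ivec q))\<^sup>2"
  shows "\<bar>M_const P A / l\<^sup>2 * (\<Sum>p\<in>P. A p * (\<Sum>q\<in>neighbor_offsets p. f (y + l *\<^sub>R ivec q) - f y))
          - (B (axis 1 1) (axis 1 1) + B (axis 2 1) (axis 2 1))\<bar>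
    \<le> e * (\<bar>M_const P A\<bar> * (\<Sum>p\<in>P. \<bar>A p\<bar> * (\<Sum>q\<in>neighbor_offsets p. (norm (ivec q))\<^sup>2)))"
proof -
  let ?T = "B (axis 1 1) (axis 1 1) + B (axis 2 1) (axis 2 1)"
  define M where "M = M_const P A"
  define R where "R q = f (y + l *\<^sub>R ivec q) - f y - Df (l *\<^sub>R ivec q)
      - B (l *\<^sub>R ivec q) (l *\<^sub>R ivec q) / 2" for q
  have inner: "(\<Sum>q\<in>neighbor_offsets p. f (y + l *\<^sub>R ivec q) - f y) =
      2 * l\<^sup>2 * ?T * ((pnorm p)\<^sup>2 * cst p) + (\<Sum>q\<in>neighbor_offsets p. R q)" if "p \<in> P" for p
  proof -
    have "(\<Sum>q\<in>neighbor_offsets p. f (y + l *\<^sub>R ivec q) - f y) =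
        (\<Sum>q\<in>neighbor_offsets p. l * Df (ivec q) + l\<^sup>2 / 2 * B (ivec q) (ivec q) + R q)"
      by (rule sum.cong) (auto simp: R_def blinfun.bilinear_simps power2_eq_square)
    also have "\<dots> = l * (\<Sum>q\<in>neighbor_offsets p. Df (ivec q))
        + l\<^sup>2 / 2 * (\<Sum>q\<in>neighbor_offsets p. B (ivec q) (ivec q)) + (\<Sum>q\<in>neighbor_offsets p. R q)"
      by (simp only: sum.distrib sum_distrib_left)
    finally show ?thesis
      using P that sum_linear_neighbor_offsets[of p Df] sum_quadratic_neighbor_offsets[of p B]
      by (simp add: algebra_simps)
  qed
  have "(\<Sum>p\<in>P. A p * (\<Sum>q\<in>neighbor_offsets p. f (y + l *\<^sub>R ivec q) - f y)) =
      (\<Sum>p\<in>P. 2 * l\<^sup>2 * ?T * ((pnorm p)\<^sup>2 * cst p * A p) + A p * (\<Sum>q\<in>neighbor_offsets p. R q))"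
    by (rule sum.cong) (simp_all add: inner algebra_simps)
  also have "\<dots> = 2 * l\<^sup>2 * ?T * (\<Sum>p\<in>P. (pnorm p)\<^sup>2 * cst p * A p)
      + (\<Sum>p\<in>P. A p * (\<Sum>q\<in>neighbor_offsets p. R q))"
    by (simp only: sum.distrib sum_distrib_left)
  finally have "M / l\<^sup>2 * (\<Sum>p\<in>P. A p * (\<Sum>q\<in>neighbor_offsets p. f (y + l *\<^sub>R ivec q) - f y)) - ?T
      = M / l\<^sup>2 * (\<Sum>p\<in>P. A p * (\<Sum>q\<in>neighbor_offsets p. R q))"
    using nz l by (simp add: M_def M_const_def field_simps)
  also have "\<bar>\<dots>\<bar> = \<bar>M\<bar> / l\<^sup>2 * \<bar>\<Sum>p\<in>P. A p * (\<Sum>q\<in>neighbor_offsets p. R q)\<bar>"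
    using l by (simp add: abs_mult)
  also have "\<dots> \<le> \<bar>M\<bar> / l\<^sup>2 * (\<Sum>p\<in>P. \<bar>A p\<bar> * (\<Sum>q\<in>neighbor_offsets p. e * (l\<^sup>2 * (norm (ivec q))\<^sup>2)))"
  proof (intro mult_left_mono order_trans[OF sum_abs] sum_mono)
    fix p assume p: "p \<in> P"
    have "\<bar>\<Sum>q\<in>neighbor_offsets p. R q\<bar> \<le> (\<Sum>q\<in>neighbor_offsets p. e * (l\<^sup>2 * (norm (ivec q))\<^sup>2))"
      using taylor[OF p] by (intro order_trans[OF sum_abs] sum_mono) (simp add: R_def power_mult_distrib)
    then show "\<bar>A p * (\<Sum>q\<in>neighbor_offsets p. R q)\<bar>
        \<le> \<bar>A p\<bar> * (\<Sum>q\<in>neighbor_offsets p. e * (l\<^sup>2 * (norm (ivec q))\<^sup>2))"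
      by (simp add: abs_mult mult_left_mono)
  qed auto
  also have "(\<Sum>p\<in>P. \<bar>A p\<bar> * (\<Sum>q\<in>neighbor_offsets p. e * (l\<^sup>2 * (norm (ivec q))\<^sup>2))) =
      e * l\<^sup>2 * (\<Sum>p\<in>P. \<bar>A p\<bar> * (\<Sum>q\<in>neighbor_offsets p. (norm (ivec q))\<^sup>2))"
    by (simp add: sum_distrib_left mult_ac)
  finally show ?thesis using l by (simp add: M_def mult.left_commute)
qed

section \<open>The discrete Laplacian as a mean of difference quotients\<close>

lemma dyadic_square_eq_iff: "dyadic_square m g = dyadic_square m h \<longleftrightarrow> g = h"
proof -
  have "ivec g = ivec h \<longleftrightarrow> g = h" by (simp add: vec_eq_iff forall_2 prod_eq_iff)
  then show ?thesis by (simp add: dyadic_square_eq_sq sq_eq_iff)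
qed

lemma dyadic_square_shift:
  "dyadic_square m (g + q) = cbox ((1/2)^m *\<^sub>R ivec g + (1/2)^m *\<^sub>R ivec q)
     ((1/2)^m *\<^sub>R ivec (g + (1, 1)) + (1/2)^m *\<^sub>R ivec q)"
  by (simp add: dyadic_square_def ivec_add algebra_simps)

lemma dyadic_square_subset_unit_square:
  assumes "dyadic_square m g \<subseteq> unit_square"
  shows "g \<in> {0..<2^m} \<times> {0..<2^m}"
proof -
  have "(1/2)^m *\<^sub>R ivec g \<in> unit_square" "(1/2)^m *\<^sub>R ivec (g + (1, 1)) \<in> unit_square"
    using assms by (auto simp: mem_dyadic_square)
  then have "0 \<le> real_of_int (fst g) \<and> real_of_int (fst g + 1) \<le> 2 ^ m"
    "0 \<le> real_of_int (snd g) \<and> real_of_int (snd g + 1) \<le> 2 ^ m"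
    by (auto simp: unit_square_eq_dyadic_square mem_dyadic_square power_one_over field_simps)
  then have "0 \<le> fst g \<and> fst g + 1 \<le> 2 ^ m" "0 \<le> snd g \<and> snd g + 1 \<le> 2 ^ m"
    by (metis of_int_0_le_iff of_int_le_iff of_int_numeral of_int_power)+
  then show ?thesis by (auto simp: mem_Times_iff)
qed

lemma cell_subset_unit_square: "cell w \<subseteq> unit_square"
proof -
  have "F i x \<in> unit_square" if "x \<in> unit_square" for i x
    using that by (auto simp: F_def corner_def unit_square_def mem_box_cart forall_2)
  then have "Fw w x \<in> unit_square" if "x \<in> unit_square" for x
    using that by (induction w) auto
  then show ?thesis by (auto simp: cell_def)
qed

lemma complete_cellD:
  assumes "complete_cell P w" "p \<in> P" "q \<in> neighbor_offsets p"
  shows "dyadic_square (length w) (grid w + q) \<subseteq> unit_square"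
  using assms unfolding complete_cell_def cell_eq_dyadic_square p_neighbor_dyadic_square_iff by blast

text \<open>Injectivity and the inclusion into the offsets hold for every cell. Completeness is needed
  to realize every offset: it keeps the neighboring grid square inside the unit square, where
  each grid square is the cell of a word.\<close>
lemma bij_betw_neighbor_words:
  assumes "complete_cell P w" "p \<in> P" "w \<in> words m"
  shows "bij_betw (\<lambda>w'. grid w' - grid w)
    {w' \<in> words m. p_neighbor p (cell w') (cell w)} (neighbor_offsets p)"
proof -
  have len: "length w = m" using assms(3) by (simp add: words_def)
  have iff: "p_neighbor p (cell w') (cell w) \<longleftrightarrow> grid w' - grid w \<in> neighbor_offsets p"
    if "w' \<in> words m" for w'
  proof -
    have "length w' = m" using that by (simp add: words_def)
    then have "p_neighbor p (cell w') (cell w) \<longleftrightarrow> (\<exists>q\<in>neighbor_offsets p. grid w' = grid w + q)"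
      by (simp add: cell_eq_dyadic_square p_neighbor_dyadic_square_iff len dyadic_square_eq_iff)
    then show ?thesis by (metis add_diff_cancel_left' add.commute diff_add_cancel)
  qed
  show ?thesis
  proof (rule bij_betw_imageI)
    show "inj_on (\<lambda>w'. grid w' - grid w) {w' \<in> words m. p_neighbor p (cell w') (cell w)}"
      using inj_on_grid[of m] by (auto simp: inj_on_def)
    show "(\<lambda>w'. grid w' - grid w) ` {w' \<in> words m. p_neighbor p (cell w') (cell w)} = neighbor_offsets p"
    proof (intro equalityI subsetI)
      fix q assume q: "q \<in> neighbor_offsets p"
      have "grid w + q \<in> {0..<2^m} \<times> {0..<2^m}"
        using complete_cellD[OF assms(1,2) q] dyadic_square_subset_unit_square len by blast
      then obtain w' where w': "w' \<in> words m" "grid w' = grid w + q" by (rule grid_surj)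
      then show "q \<in> (\<lambda>w'. grid w' - grid w) ` {w' \<in> words m. p_neighbor p (cell w') (cell w)}"
        using q iff by (intro image_eqI[of _ _ w']) auto
    qed (auto simp: iff)
  qed
qed

lemma measure_dyadic_square: "measure lborel (dyadic_square m g) = (1/4)^m"
proof -
  have "(1/2)^m *\<^sub>R ivec g \<in> dyadic_square m g" by (simp add: mem_dyadic_square)
  then have "measure lborel (dyadic_square m g) = (1/2)^m * (1/2)^m"
    unfolding dyadic_square_def by (subst content_cbox_cart) (auto simp: UNIV_2 algebra_simps)
  then show ?thesis by (simp flip: power_mult_distrib)
qed

lemma avg_eq_integral:
  assumes "continuous_on (cell w) f"
  shows "avg w f = 4 ^ length w * integral (cell w) f"
proof -
  have "compact (cell w)" by (simp add: cell_eq_dyadic_square dyadic_square_def)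
  then have "set_integrable lborel (cell w) f"
    using borel_integrable_compact assms unfolding set_integrable_def by blast
  then have "(LINT y:cell w|lborel. f y) = integral (cell w) f"
    by (rule set_borel_integral_eq_integral)
  moreover have "measure lborel (cell w) = (1/4) ^ length w"
    by (simp add: cell_eq_dyadic_square measure_dyadic_square)
  ultimately show ?thesis by (simp add: avg_def power_one_over)
qed

text \<open>Each neighbor is a translate of the cell, so its mean is the mean of a translated function
  over the cell itself. The factor \<open>(1/4)\<^sup>m\<close> is the area of the cell.\<close>
lemma discrete_laplacian_has_integral:
  assumes P: "\<forall>p\<in>P. 0 \<le> fst p \<and> fst p \<le> snd p"
    and fin: "finite P"
    and norm: "8 * (\<Sum>p\<in>P. cst p * A p) = 1"
    and cont: "continuous_on unit_square f"
    and w: "w \<in> words m" "complete_cell P w"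
  shows "((\<lambda>y. M_const P A / ((1/2)^m)\<^sup>2 *
           (\<Sum>p\<in>P. A p * (\<Sum>q\<in>neighbor_offsets p. f (y + (1/2)^m *\<^sub>R ivec q) - f y)))
         has_integral (1/4)^m * discrete_laplacian P A f w) (cell w)"
proof -
  define g where "g = grid w"
  define l where "l = (1/2::real)^m"
  have len: "length w = m" using w by (simp add: words_def)
  have cell: "cell w = dyadic_square m g" by (simp add: cell_eq_dyadic_square len g_def)
  define J where "J q = integral (dyadic_square m (g + q)) f" for q
  have shifted: "((\<lambda>y. f (y + l *\<^sub>R ivec q)) has_integral J q) (cell w)"
    if sub: "dyadic_square m (g + q) \<subseteq> unit_square" for q
  proof -
    have "f integrable_on dyadic_square m (g + q)"
      using continuous_on_subset[OF cont sub] integrable_continuous unfolding dyadic_square_def by blast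
    then have "(f has_integral J q) (cbox (l *\<^sub>R ivec g + l *\<^sub>R ivec q) (l *\<^sub>R ivec (g + (1, 1)) + l *\<^sub>R ivec q))"
      unfolding J_def using dyadic_square_shift l_def by (metis integrable_integral)
    from has_integral_shift_cbox[OF this, of "l *\<^sub>R ivec q"]
    show "((\<lambda>y. f (y + l *\<^sub>R ivec q)) has_integral J q) (cell w)"
      by (simp add: cell dyadic_square_def l_def)
  qed
  have sub0: "dyadic_square m (g + 0) \<subseteq> unit_square"
    using cell_subset_unit_square[of w] by (simp add: cell)
  have base: "(f has_integral J 0) (cell w)"
  proof -
    have "ivec 0 = 0" by (simp add: vec_eq_iff forall_2)
    then show ?thesis using shifted[OF sub0] by simp
  qed
  have subq: "dyadic_square m (g + q) \<subseteq> unit_square" if "p \<in> P" "q \<in> neighbor_offsets p" for p q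
    using complete_cellD[OF w(2) that] by (simp add: len g_def)
  have avg: "avg v f = 4^m * J (grid v - g)"
    if "v \<in> words m" for v
  proof -
    have "length v = m" using that by (simp add: words_def)
    then show ?thesis
      using avg_eq_integral[OF continuous_on_subset[OF cont cell_subset_unit_square]]
      by (simp add: J_def cell_eq_dyadic_square)
  qed
  have inner: "(\<Sum>w' | w' \<in> words m \<and> p_neighbor p (cell w') (cell w). avg w' f)
      = 4^m * (\<Sum>q\<in>neighbor_offsets p. J q)" if "p \<in> P" for p
    using sum.reindex_bij_betw[OF bij_betw_neighbor_words[OF w(2) that w(1)], of J]
    by (simp add: avg g_def flip: sum_distrib_left)
  \<comment> \<open>The \<open>8 c\<^sub>p\<close> copies of the central mean, weighted by \<open>A\<^sub>p\<close>, add up to exactly one copy.\<close>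
  have "(\<Sum>p\<in>P. A p * (\<Sum>q\<in>neighbor_offsets p. J q - J 0)) =
      (\<Sum>p\<in>P. A p * (\<Sum>q\<in>neighbor_offsets p. J q) - 8 * J 0 * (cst p * A p))"
    using P by (intro sum.cong) (simp_all add: sum_subtractf card_neighbor_offsets algebra_simps)
  also have "\<dots> = (\<Sum>p\<in>P. A p * (\<Sum>q\<in>neighbor_offsets p. J q)) - J 0 * (8 * (\<Sum>p\<in>P. cst p * A p))"
    by (simp add: sum_subtractf sum_distrib_left mult_ac)
  finally have normalized: "(\<Sum>p\<in>P. A p * (\<Sum>q\<in>neighbor_offsets p. J q - J 0)) =
      (\<Sum>p\<in>P. A p * (\<Sum>q\<in>neighbor_offsets p. J q)) - J 0"
    by (simp add: norm)
  have "discrete_laplacian P A f w = M_const P A * 4^m *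
      ((\<Sum>p\<in>P. A p * (4^m * (\<Sum>q\<in>neighbor_offsets p. J q))) - 4^m * J 0)"
    unfolding discrete_laplacian_def using avg[OF w(1)]
    by (simp add: len inner g_def)
  also have "(\<Sum>p\<in>P. A p * (4^m * (\<Sum>q\<in>neighbor_offsets p. J q))) =
      4^m * (\<Sum>p\<in>P. A p * (\<Sum>q\<in>neighbor_offsets p. J q))"
    by (subst sum_distrib_left) (simp add: mult_ac)
  finally have "(1/4)^m * discrete_laplacian P A f w =
      M_const P A * 4^m * ((\<Sum>p\<in>P. A p * (\<Sum>q\<in>neighbor_offsets p. J q)) - J 0)"
    by (simp add: power_one_over field_simps)
  also have "\<dots> = M_const P A / l\<^sup>2 * (\<Sum>p\<in>P. A p * (\<Sum>q\<in>neighbor_offsets p. J q - J 0))"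
  proof -
    have "l\<^sup>2 = 1 / 4^m"
      by (simp add: l_def power2_eq_square power_one_over flip: power_mult_distrib)
    then show ?thesis unfolding normalized by simp
  qed
  finally have scaled: "(1/4)^m * discrete_laplacian P A f w =
      M_const P A / l\<^sup>2 * (\<Sum>p\<in>P. A p * (\<Sum>q\<in>neighbor_offsets p. J q - J 0))" .
  show ?thesis
    unfolding scaled l_def[symmetric]
    by (intro has_integral_mult_right has_integral_sum has_integral_diff fin
        finite_neighbor_offsets shifted base subq)
qed

section \<open>Uniform convergence\<close>

text \<open>The error is split into the Taylor remainder at \<open>y\<close> and the oscillation of the Laplacian
  between two points of the cell. Both are small uniformly, and averaging over \<open>y\<close>
  preserves the bound.\<close>
lemma discrete_laplacian_uniform_limit_complete_cells:
  assumes P: "finite P" "\<forall>p\<in>P. 0 \<le> fst p \<and> fst p \<le> snd p"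
    and norm: "8 * (\<Sum>p\<in>P. cst p * A p) = 1"
    and nz: "(\<Sum>p\<in>P. (pnorm p)\<^sup>2 * cst p * A p) \<noteq> 0"
    and C2: "C2_on unit_square f"
    and "\<epsilon> > 0"
  shows "\<forall>\<^sub>F m in sequentially. \<forall>x\<in>interior unit_square. \<forall>w\<in>words m.
           x \<in> cell w \<and> complete_cell P w \<longrightarrow> \<bar>discrete_laplacian P A f w - laplacian f x\<bar> < \<epsilon>"
proof -
  obtain Df D2f where
    Df: "\<And>x. x \<in> unit_square \<Longrightarrow> (f has_derivative blinfun_apply (Df x)) (at x within unit_square)" and
    D2f: "\<And>x. x \<in> unit_square \<Longrightarrow> (Df has_derivative blinfun_apply (D2f x)) (at x within unit_square)" and
    contD2f: "continuous_on unit_square D2f"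
    using C2 unfolding C2_on_def by blast
  have S: "compact unit_square" "convex unit_square"
    by (simp_all add: unit_square_def compact_cbox)
  have contf: "continuous_on unit_square f"
    by (rule has_derivative_continuous_on) (rule Df)
  define T where "T x = D2f x (axis 1 1) (axis 1 1) + D2f x (axis 2 1) (axis 2 1)" for x
  define C where "C = \<bar>M_const P A\<bar> * (\<Sum>p\<in>P. \<bar>A p\<bar> * (\<Sum>q\<in>neighbor_offsets p. (norm (ivec q))\<^sup>2))"
  have C: "C \<ge> 0" unfolding C_def by (intro mult_nonneg_nonneg sum_nonneg) auto
  \<comment> \<open>\<open>C\<close> is the constant of \<open>difference_sum_estimate\<close>; it may vanish, hence \<open>C + 1\<close>.\<close>
  define e where "e = \<epsilon> / (3 * (C + 1))"
  have e: "e > 0" "e * C \<le> \<epsilon> / 3"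
    using \<open>\<epsilon> > 0\<close> C by (auto simp: e_def field_simps)
  obtain d where d: "d > 0"
    "\<And>x h. x \<in> unit_square \<Longrightarrow> x + h \<in> unit_square \<Longrightarrow> norm h < d \<Longrightarrow>
       \<bar>f (x + h) - f x - Df x h - D2f x h h / 2\<bar> \<le> e * (norm h)\<^sup>2"
    using uniform_second_order_Taylor[OF S Df D2f contD2f e(1)] by blast
  have "continuous_on unit_square T"
    unfolding T_def by (intro continuous_intros contD2f)
  then have "uniformly_continuous_on unit_square T"
    using S(1) compact_uniformly_continuous by blast
  then obtain d' where d': "d' > 0"
    "\<And>x y. x \<in> unit_square \<Longrightarrow> y \<in> unit_square \<Longrightarrow> dist y x < d' \<Longrightarrow> dist (T y) (T x) < \<epsilon> / 3"
    unfolding uniformly_continuous_on_def using \<open>\<epsilon> > 0\<close> by (metis divide_pos_pos zero_less_numeral)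
  \<comment> \<open>\<open>R\<close> bounds all offsets, and \<open>l R\<close> also bounds the diameter of a cell because \<open>R \<ge> 2\<close>.\<close>
  define R where "R = (\<Sum>p\<in>P. \<Sum>q\<in>neighbor_offsets p. norm (ivec q)) + 2"
  have R: "R \<ge> 2" unfolding R_def by (auto intro!: sum_nonneg)
  have normR: "norm (ivec q) \<le> R" if "p \<in> P" "q \<in> neighbor_offsets p" for p q
  proof -
    have "norm (ivec q) \<le> (\<Sum>q\<in>neighbor_offsets p. norm (ivec q))"
      using that finite_neighbor_offsets by (intro member_le_sum) auto
    also have "\<dots> \<le> (\<Sum>p\<in>P. \<Sum>q\<in>neighbor_offsets p. norm (ivec q))"
      using that P(1) by (intro member_le_sum[of p P]) (auto intro: sum_nonneg)
    finally show ?thesis by (simp add: R_def)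
  qed
  have "(\<lambda>m. (1/2::real)^m * R) \<longlonglongrightarrow> 0"
    by (intro tendsto_mult_left_zero LIMSEQ_power_zero) simp
  then have "\<forall>\<^sub>F m in sequentially. (1/2::real)^m * R < min d d'"
    using d(1) d'(1) by (intro order_tendstoD) auto
  then show ?thesis
  proof eventually_elim
    case (elim m)
    show ?case
    proof (intro ballI impI)
      fix x w assume x: "x \<in> interior unit_square" and w: "w \<in> words m"
        and "x \<in> cell w \<and> complete_cell P w"
      then have xw: "x \<in> cell w" and complete: "complete_cell P w" by auto
      have len: "length w = m" using w by (simp add: words_def)
      define l where "l = (1/2::real)^m"
      have l: "l > 0" by (simp add: l_def)
      have lR: "l * R < d" "l * R < d'" using elim by (auto simp: l_def)
      define G where "G y = M_const P A / l\<^sup>2 *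
        (\<Sum>p\<in>P. A p * (\<Sum>q\<in>neighbor_offsets p. f (y + l *\<^sub>R ivec q) - f y))" for y
      have G: "\<bar>G y - T x\<bar> \<le> 2 * \<epsilon> / 3" if y: "y \<in> cell w" for y
      proof -
        have yS: "y \<in> unit_square" and xS: "x \<in> unit_square"
          using y xw cell_subset_unit_square[of w] by auto
        have "\<bar>G y - T y\<bar> \<le> e * C"
          unfolding G_def T_def C_def
        proof (rule difference_sum_estimate[OF P(2) nz l])
          fix p q assume pq: "p \<in> P" "q \<in> neighbor_offsets p"
          have "y + l *\<^sub>R ivec q \<in> dyadic_square m (grid w + q)"
            using y by (simp add: cell_eq_dyadic_square mem_dyadic_square len l_def algebra_simps)
          then have "y + l *\<^sub>R ivec q \<in> unit_square"
            using complete_cellD[OF complete pq] len by auto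
          moreover have "norm (l *\<^sub>R ivec q) < d"
          proof -
            have "l * norm (ivec q) \<le> l * R"
              using l by (intro mult_left_mono normR[OF pq]) simp
            moreover have "norm (l *\<^sub>R ivec q) = l * norm (ivec q)" using l by simp
            ultimately show ?thesis using lR(1) by linarith
          qed
          ultimately show "\<bar>f (y + l *\<^sub>R ivec q) - f y - Df y (l *\<^sub>R ivec q)
              - D2f y (l *\<^sub>R ivec q) (l *\<^sub>R ivec q) / 2\<bar> \<le> e * (norm (l *\<^sub>R ivec q))\<^sup>2"
            by (rule d(2)[OF yS])
        qed
        moreover have "dist y x < d'"
        proof -
          have "\<bar>y $ 1 - x $ 1\<bar> \<le> l" "\<bar>y $ 2 - x $ 2\<bar> \<le> l"
            using y xw by (auto simp: cell_eq_dyadic_square mem_dyadic_square len l_def algebra_simps)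
          then have "dist y x \<le> l * 2"
            using norm_le_l1_cart[of "y - x"] by (simp add: dist_norm sum_2)
          also have "\<dots> \<le> l * R" using R l by simp
          finally show ?thesis using lR(2) by simp
        qed
        then have "\<bar>T y - T x\<bar> < \<epsilon> / 3" using d'(2)[OF xS yS] by (simp add: dist_real_def)
        ultimately show ?thesis using e(2) by linarith
      qed
      have "(G has_integral (1/4)^m * discrete_laplacian P A f w) (cell w)"
        unfolding G_def l_def
        by (rule discrete_laplacian_has_integral[OF P(2,1) norm contf w complete])
      moreover have "((\<lambda>_. T x) has_integral (1/4)^m * T x) (cell w)"
        using has_integral_const[of "T x" "(1/2)^m *\<^sub>R ivec (grid w)" "(1/2)^m *\<^sub>R ivec (grid w + (1, 1))"]
        by (simp add: cell_eq_dyadic_square len measure_dyadic_square flip: dyadic_square_def)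
      ultimately have *: "((\<lambda>y. G y - T x) has_integral
          (1/4)^m * (discrete_laplacian P A f w - T x)) (cell w)"
        unfolding right_diff_distrib by (rule has_integral_diff)
      have "norm ((1/4)^m * (discrete_laplacian P A f w - T x)) \<le> (2 * \<epsilon> / 3) * measure lborel (cell w)"
        unfolding cell_eq_dyadic_square dyadic_square_def
      proof (rule has_integral_bound)
        show "0 \<le> 2 * \<epsilon> / 3" using \<open>\<epsilon> > 0\<close> by simp
      qed (use * G in \<open>simp_all add: cell_eq_dyadic_square dyadic_square_def\<close>)
      then have "\<bar>discrete_laplacian P A f w - T x\<bar> \<le> 2 * \<epsilon> / 3"
        by (simp add: cell_eq_dyadic_square measure_dyadic_square len abs_mult power_one_over divide_simps)
      moreover have "laplacian f x = T x"
        unfolding T_def by (rule laplacian_eq[OF Df D2f x])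
      ultimately show "\<bar>discrete_laplacian P A f w - laplacian f x\<bar> < \<epsilon>"
        using \<open>\<epsilon> > 0\<close> by simp
    qed
  qed
qed

text \<open>A neighbor of a cell through \<open>x\<close> lies within distance \<open>2 l R\<close> of \<open>x\<close>, where \<open>R\<close> depends only
  on \<open>P\<close>; eventually this is less than the distance of \<open>K\<close> from the boundary.\<close>
lemma eventually_complete_cell:
  assumes P: "finite P" and K: "compact K" "K \<subseteq> interior unit_square"
  shows "\<forall>\<^sub>F m in sequentially. \<forall>x\<in>K. \<forall>w\<in>words m. x \<in> cell w \<longrightarrow> complete_cell P w"
proof -
  obtain d where d: "d > 0" "(\<Union>x\<in>K. ball x d) \<subseteq> interior unit_square"
    using compact_subset_open_imp_ball_epsilon_subset[OF K(1) open_interior K(2)] by blast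
  define R where "R = (\<Sum>p\<in>P. \<bar>fst p\<bar> + \<bar>snd p\<bar>) + 1"
  have R: "\<bar>fst q\<bar> + 1 \<le> R \<and> \<bar>snd q\<bar> + 1 \<le> R" if "p \<in> P" "q \<in> neighbor_offsets p" for p q
  proof -
    have "\<bar>fst p\<bar> + \<bar>snd p\<bar> + 1 \<le> R"
      unfolding R_def using that P by (intro add_right_mono member_le_sum[of p P]) auto
    then show ?thesis using that by (auto simp: neighbor_offsets_def)
  qed
  have "(\<lambda>m. (1/2::real)^m * (2 * R)) \<longlonglongrightarrow> 0"
    by (intro tendsto_mult_left_zero LIMSEQ_power_zero) simp
  then have "\<forall>\<^sub>F m in sequentially. (1/2::real)^m * (2 * R) < d"
    using d(1) by (intro order_tendstoD) auto
  then show ?thesis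
  proof eventually_elim
    case (elim m)
    show ?case
    proof (intro ballI impI)
      fix x w assume x: "x \<in> K" and w: "w \<in> words m" and xw: "x \<in> cell w"
      have len: "length w = m" using w by (simp add: words_def)
      define l where "l = (1/2::real)^m"
      have l: "l > 0" by (simp add: l_def)
      have "dyadic_square m (grid w + q) \<subseteq> unit_square" if pq: "p \<in> P" "q \<in> neighbor_offsets p" for p q
      proof
        fix y assume y: "y \<in> dyadic_square m (grid w + q)"
        have bound: "\<bar>a - b\<bar> \<le> l * R" if "l * c \<le> b" "b \<le> l * (c + 1)"
          "l * (c + of_int k) \<le> a" "a \<le> l * (c + of_int k + 1)" "\<bar>k\<bar> + 1 \<le> R" for a b c k
        proof -
          have "\<bar>a - b\<bar> \<le> l * of_int (\<bar>k\<bar> + 1)"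
          proof -
            have "l * of_int k \<le> l * \<bar>of_int k\<bar>" "- (l * of_int k) \<le> l * \<bar>of_int k\<bar>"
              using l by (auto simp: abs_if)
            then show ?thesis using that(1-4) by (simp add: algebra_simps abs_le_iff)
          qed
          also have "\<dots> \<le> l * R" using that(5) l by (intro mult_left_mono) linarith+
          finally show ?thesis .
        qed
        have "\<bar>y $ 1 - x $ 1\<bar> \<le> l * R"
          using y xw R[OF pq] by (intro bound[of "of_int (fst (grid w))" _ "fst q"])
            (auto simp: cell_eq_dyadic_square mem_dyadic_square len l_def)
        moreover have "\<bar>y $ 2 - x $ 2\<bar> \<le> l * R"
          using y xw R[OF pq] by (intro bound[of "of_int (snd (grid w))" _ "snd q"])
            (auto simp: cell_eq_dyadic_square mem_dyadic_square len l_def)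
        ultimately have "dist x y \<le> l * (2 * R)"
          using norm_le_l1_cart[of "y - x"] by (simp add: dist_norm norm_minus_commute sum_2)
        then have "y \<in> ball x d" using elim by (simp add: l_def)
        then show "y \<in> unit_square" using d(2) x interior_subset by blast
      qed
      then show "complete_cell P w"
        unfolding complete_cell_def cell_eq_dyadic_square p_neighbor_dyadic_square_iff len by blast
    qed
  qed
qed

theorem theorem3p4:
  fixes P :: "(int \<times> int) set" and A :: "int \<times> int \<Rightarrow> real" and f :: "real^2 \<Rightarrow> real"
  assumes "finite P"
    and "\<forall>p\<in>P. 0 \<le> fst p \<and> fst p \<le> snd p \<and> snd p \<noteq> 0"
    and "8 * (\<Sum>p\<in>P. cst p * A p) = 1"
    and "(\<Sum>p\<in>P. (pnorm p)\<^sup>2 * cst p * A p) \<noteq> 0"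
    and "C2_on unit_square f"
  shows "(\<forall>W K. (\<forall>m. \<forall>x\<in>unit_square - frontier unit_square. W m x \<in> words m \<and> x \<in> cell (W m x)) \<and>
             compact K \<and> K \<subseteq> unit_square - frontier unit_square \<longrightarrow>
             uniform_limit K (\<lambda>m x. discrete_laplacian P A f (W m x)) (laplacian f) sequentially) \<and>
         (\<forall>\<epsilon>>0. \<forall>\<^sub>F m in sequentially. \<forall>x\<in>unit_square - frontier unit_square. \<forall>w\<in>words m.
             x \<in> cell w \<and> complete_cell P w \<longrightarrow>
             \<bar>discrete_laplacian P A f w - laplacian f x\<bar> < \<epsilon>)"
proof -
  have "closed unit_square" by (simp add: unit_square_def closed_cbox)
  then have int: "unit_square - frontier unit_square = interior unit_square"
    using interior_subset[of unit_square] by (auto simp: frontier_def)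
  have complete: "\<forall>\<^sub>F m in sequentially. \<forall>x\<in>interior unit_square. \<forall>w\<in>words m.
      x \<in> cell w \<and> complete_cell P w \<longrightarrow> \<bar>discrete_laplacian P A f w - laplacian f x\<bar> < \<epsilon>"
    if "\<epsilon> > 0" for \<epsilon>
    using assms that by (intro discrete_laplacian_uniform_limit_complete_cells) auto
  have "uniform_limit K (\<lambda>m x. discrete_laplacian P A f (W m x)) (laplacian f) sequentially"
    if W: "\<forall>m. \<forall>x\<in>interior unit_square. W m x \<in> words m \<and> x \<in> cell (W m x)"
      and K: "compact K" "K \<subseteq> interior unit_square" for W K
  proof (rule uniform_limitI)
    fix \<epsilon> :: real assume "\<epsilon> > 0"
    from complete[OF this] eventually_complete_cell[OF assms(1) K]
    show "\<forall>\<^sub>F m in sequentially. \<forall>x\<in>K. dist (discrete_laplacian P A f (W m x)) (laplacian f x) < \<epsilon>"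
      by eventually_elim (use W K in \<open>auto simp: dist_real_def\<close>)
  qed
  with complete show ?thesis unfolding int by blast
qed

end
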